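(* For $n\in\mathbb N$ let $R_n(x)=\sum_{k=0}^n\binom nk\binom{n+k}k\frac{x^k}{2k-1}$ and $R_n=R_n(1)$. (i) For any odd prime $p$, $$\sum_{k=0}^{p-1}R_k\equiv-p-\left(\frac{-1}p\right)\pmod{p^2}.$$ (ii) For any positive integer $n$, $R_n(-1)=-(2n+1)$, and $$\sum_{k=0}^n\frac{\binom nk\binom{-n}k}{2k-1}=-2n.$$
   Context: $\left(\frac{\cdot}{p}\right)$ is the Legendre symbol. For an integer $m$ and $k\in\mathbb N$, $\binom mk=m(m-1)\cdots(m-k+1)/k!$ (so negative upper arguments are allowed). $R_n(x)\in\mathbb Z[x]$ since $(2k-1)\mid\binom{2k}k$. *)

theory Defs
  imports
    "HOL-Number_Theory.Number_Theory"
    "HOL-Computational_Algebra.Polynomial"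
begin

(* The coefficients are written with integer division; it is exact (R_coeff_dvd), and
   of_int_poly_R gives the defining formula with genuine division. *)

definition R :: "nat \<Rightarrow> int poly" where
  "R n = (\<Sum>k=0..n. Polynomial.monom (int ((n choose k) * ((n + k) choose k)) div (2 * int k - 1)) k)"

lemma central_binomial_dvd: "(2 * int k - 1) dvd int ((2 * k) choose k)"
proof (cases k)
  case 0
  then show ?thesis by simp
next
  case (Suc m)
  have 1: "Suc m * (Suc (Suc (2 * m)) choose Suc m) = Suc (Suc (2 * m)) * (Suc (2 * m) choose m)"
    by (rule Suc_times_binomial)
  have 2: "Suc (2 * m) choose m = Suc (2 * m) choose Suc m"
    using binomial_symmetric[of m "Suc (2 * m)"] by simp
  have 3: "Suc m * (Suc (2 * m) choose Suc m) = Suc (2 * m) * ((2 * m) choose m)"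
    by (rule Suc_times_binomial)
  have 4: "(Suc (2 * m)) dvd Suc m * (Suc (2 * m) choose Suc m)"
    unfolding 3 by (rule dvd_triv_left)
  have cop: "coprime (Suc (2 * m)) (Suc m)"
  proof -
    have "coprime (Suc m) m" by simp
    moreover have "Suc (2 * m) = m + Suc m" by simp
    ultimately show ?thesis
      by (metis coprime_commute coprime_iff_gcd_eq_1 gcd_add1)
  qed
  from 4 cop have "Suc (2 * m) dvd (Suc (2 * m) choose Suc m)"
    using coprime_dvd_mult_right_iff by blast
  then have "Suc (2 * m) dvd Suc m * (Suc (Suc (2 * m)) choose Suc m)"
    unfolding 1 2 by (rule dvd_mult)
  with cop have "Suc (2 * m) dvd (Suc (Suc (2 * m)) choose Suc m)"
    using coprime_dvd_mult_right_iff by blast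
  then have "int (Suc (2 * m)) dvd int (Suc (Suc (2 * m)) choose Suc m)"
    by (simp only: int_dvd_int_iff)
  moreover have "2 * int k - 1 = int (Suc (2 * m))" "2 * k = Suc (Suc (2 * m))"
    using Suc by simp_all
  ultimately show ?thesis using Suc by simp
qed

lemma R_coeff_dvd:
  assumes "k \<le> n"
  shows "(2 * int k - 1) dvd int ((n choose k) * ((n + k) choose k))"
proof -
  have "((n + k) choose (2 * k)) * ((2 * k) choose k) = ((n + k) choose k) * (n choose k)"
    using choose_mult[of k "2 * k" "n + k"] assms by simp
  then have "int ((n choose k) * ((n + k) choose k)) =
      int ((n + k) choose (2 * k)) * int ((2 * k) choose k)"
    by (metis mult.commute of_nat_mult)
  then show ?thesis by (simp add: central_binomial_dvd)
qed

lemma of_int_poly_R: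
  fixes x :: int
  shows "(of_int (poly (R n) x) :: rat) =
    (\<Sum>k=0..n. of_nat (n choose k) * of_nat ((n + k) choose k) * (of_int x ^ k / (2 * of_nat k - 1)))"
proof -
  have "(of_int (poly (R n) x) :: rat) =
    (\<Sum>k=0..n. of_int (int ((n choose k) * ((n + k) choose k)) div (2 * int k - 1)) * of_int x ^ k)"
    by (simp add: R_def poly_sum poly_monom)
  also have "\<dots> =
    (\<Sum>k=0..n. of_nat (n choose k) * of_nat ((n + k) choose k) * (of_int x ^ k / (2 * of_nat k - 1)))"
  proof (rule sum.cong)
    fix k assume "k \<in> {0..n}"
    then have "(of_int (int ((n choose k) * ((n + k) choose k)) div (2 * int k - 1)) :: rat)
        = of_int (int ((n choose k) * ((n + k) choose k))) / of_int (2 * int k - 1)"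
      by (intro of_int_div R_coeff_dvd) simp
    then show "of_int (int ((n choose k) * ((n + k) choose k)) div (2 * int k - 1)) * of_int x ^ k
        = (of_nat (n choose k) * of_nat ((n + k) choose k) * (of_int x ^ k / (2 * of_nat k - 1)) :: rat)"
      by simp
  qed simp
  finally show ?thesis .
qed

end

theory Submission
  imports Defs
begin

text \<open>
  For (i), summing over \<open>n\<close> first gives
  \<open>(\<Sum>n<p. R n) = (\<Sum>k<p. p / ((2k-1)(2k+1)) * C(p-1,k) C(p+k,k))\<close>, and
  \<open>C(p-1,k) C(p+k,k) = (\<Prod>j=1..k. p^2/j^2 - 1)\<close> is congruent to \<open>(-1)^k\<close> modulo \<open>p^2\<close>.
  Partial fractions reduce the claim to \<open>(\<Sum>j<p. (-1)^j p / (2j+1))\<close>; there the terms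
  \<open>j\<close> and \<open>p-1-j\<close> add up to a multiple of \<open>p^2\<close>, except for the middle one,
  which is \<open>(-1)^((p-1)/2)\<close>.

  For (ii), put \<open>s(n,k) = (-1)^k C(n,k) C(n-1+k,k)\<close>. Then \<open>(2n-1) R n (-1) - (2n+1) R (n-1) (-1)\<close>
  equals \<open>2 * (\<Sum>k\<le>n. s(n,k))\<close>, which vanishes because \<open>n^2 s(n,k)\<close> telescopes.
  The second sum is the mean of \<open>R n (-1)\<close> and \<open>R (n-1) (-1)\<close>.
\<close>

section \<open>Contiguity relations for binomial coefficients over the rationals\<close>

lemma binomial_mult_diff:
  "of_nat (Suc n choose k) * (of_nat n + 1 - of_nat k) = (of_nat n + 1) * (of_nat (n choose k) :: rat)"
proof (cases "k \<le> Suc n")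
  case True
  have "Suc n * (n choose k) = (Suc n - k) * (Suc n choose k)"
    using binomial_absorb_comp[of "Suc n" k] by simp
  then have "of_nat (Suc n * (n choose k)) = (of_nat ((Suc n - k) * (Suc n choose k)) :: rat)"
    by simp
  \<comment> \<open>Truncated and rational subtraction agree only for \<open>k \<le> Suc n\<close>;
    beyond that both binomials vanish, so the identity needs no bound on \<open>k\<close>.\<close>
  moreover have "of_nat (Suc n - k) = (of_nat n + 1 - of_nat k :: rat)"
    using True by (simp add: of_nat_diff)
  ultimately show ?thesis
    by (simp only: of_nat_mult of_nat_Suc mult_ac add_ac)
qed (simp add: binomial_eq_0)

lemma binomial_add_mult:
  "(of_nat n + 1) * of_nat ((Suc n + k) choose k) = (of_nat n + 1 + of_nat k) * (of_nat ((n + k) choose k) :: rat)"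
  using binomial_mult_diff[of "n + k" k] by (simp add: algebra_simps)

lemma binomial_Suc_mult:
  "(of_nat k + 1) * of_nat (n choose Suc k) = (of_nat n - of_nat k) * (of_nat (n choose k) :: rat)"
proof -
  have "(of_nat k + 1) * (of_nat n gchoose Suc k) = (of_nat n - of_nat k) * (of_nat n gchoose k :: rat)"
    using gbinomial_mult_1[of "of_nat n :: rat" k] by (simp add: algebra_simps)
  then show ?thesis by (simp add: binomial_gbinomial)
qed

lemma binomial_add_Suc_mult:
  "(of_nat k + 1) * of_nat ((n + Suc k) choose Suc k) = (of_nat n + of_nat k + 1) * (of_nat ((n + k) choose k) :: rat)"
proof -
  have "Suc k * (Suc (n + k) choose Suc k) = Suc (n + k) * ((n + k) choose k)"
    by (rule Suc_times_binomial)
  then have "of_nat (Suc k * (Suc (n + k) choose Suc k)) = (of_nat (Suc (n + k) * ((n + k) choose k)) :: rat)"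
    by (rule arg_cong)
  then show ?thesis by (simp add: algebra_simps)
qed

lemma odd_rat_nonzero: "2 * of_nat k - 1 \<noteq> (0::rat)" "2 * of_nat k + 1 \<noteq> (0::rat)"
proof -
  have "(of_int (2 * int k - 1) :: rat) \<noteq> 0"
    by (subst of_int_eq_0_iff) presburger
  then show "2 * of_nat k - 1 \<noteq> (0::rat)" by simp
  have "(of_nat (2 * k + 1) :: rat) \<noteq> 0" by (subst of_nat_eq_0_iff) simp
  then show "2 * of_nat k + 1 \<noteq> (0::rat)" by simp
qed

text \<open>The right-hand side is an antidifference in \<open>m\<close>: by the two shift relations
  it grows by exactly \<open>2 * k + 1\<close> times the summand when \<open>m\<close> becomes
  \<open>m + 1\<close>. This evaluates the sum over \<open>n\<close> of the coefficients of
  \<open>R n\<close> for fixed \<open>k\<close>.\<close>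

lemma sum_binomial_products:
  "(2 * of_nat k + 1) * (\<Sum>n<m. of_nat (n choose k) * of_nat ((n + k) choose k)) =
    (of_nat m - of_nat k) * of_nat (m choose k) * (of_nat ((m + k) choose k) :: rat)"
proof (induction m)
  case 0
  then show ?case by (cases k) simp_all
next
  case (Suc m)
  have "(of_nat (Suc m) - of_nat k) * of_nat (Suc m choose k) * (of_nat ((Suc m + k) choose k) :: rat)
      = ((of_nat m + 1) * of_nat (m choose k)) * of_nat ((Suc m + k) choose k)"
    using binomial_mult_diff[of m k] by (simp add: algebra_simps)
  also have "\<dots> = of_nat (m choose k) * ((of_nat m + 1 + of_nat k) * of_nat ((m + k) choose k))"
    using binomial_add_mult[of m k] by simp
  finally show ?case
    using Suc.IH by (simp add: algebra_simps)
qed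

section \<open>Rationals with denominator prime to \<open>p\<close>: closure properties and p-adic
  estimates\<close>

definition p_integral :: "nat \<Rightarrow> rat \<Rightarrow> bool" where
  "p_integral p x \<longleftrightarrow> (\<exists>a b. \<not> int p dvd b \<and> x = of_int a / of_int b)"

lemma p_integral_fraction: "\<not> int p dvd b \<Longrightarrow> p_integral p (of_int a / of_int b)"
  unfolding p_integral_def by blast

context
  fixes p :: nat
  assumes prime: "prime p"
begin

lemma p_integral_of_int: "p_integral p (of_int a)"
  using p_integral_fraction[of p 1 a] prime
  by (metis div_by_1 of_int_1 not_prime_unit prime_int_nat_transfer prime_nat_int_transfer)

lemma p_integral_of_nat: "p_integral p (of_nat a)"
  using p_integral_of_int[of "int a"] by simp

lemma p_integral_mult:
  assumes "p_integral p x" "p_integral p y"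
  shows "p_integral p (x * y)"
proof -
  obtain a b c d where "\<not> int p dvd b" "x = of_int a / of_int b"
    "\<not> int p dvd d" "y = of_int c / of_int d"
    using assms unfolding p_integral_def by blast
  moreover from this have "\<not> int p dvd b * d"
    using prime by (simp add: prime_dvd_mult_iff)
  ultimately show ?thesis
    using p_integral_fraction[of p "b * d" "a * c"] by simp
qed

lemma p_integral_add:
  assumes "p_integral p x" "p_integral p y"
  shows "p_integral p (x + y)"
proof -
  obtain a b c d where *: "\<not> int p dvd b" "x = of_int a / of_int b"
    "\<not> int p dvd d" "y = of_int c / of_int d"
    using assms unfolding p_integral_def by blast
  then have "\<not> int p dvd b * d" "b \<noteq> 0" "d \<noteq> 0"
    using prime by (auto simp: prime_dvd_mult_iff)
  moreover from this have "x + y = of_int (a * d + c * b) / of_int (b * d)"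
    using * by (simp add: field_simps)
  ultimately show ?thesis
    using p_integral_fraction by metis
qed

lemma p_integral_uminus: "p_integral p x \<Longrightarrow> p_integral p (- x)"
  using p_integral_mult[of "-1" x] p_integral_of_int[of "-1"] by simp

lemma p_integral_diff: "p_integral p x \<Longrightarrow> p_integral p y \<Longrightarrow> p_integral p (x - y)"
  using p_integral_add[of x "- y"] p_integral_uminus[of y] by simp

lemma p_integral_sum: "(\<And>i. i \<in> A \<Longrightarrow> p_integral p (f i)) \<Longrightarrow> p_integral p (sum f A)"
proof (induction A rule: infinite_finite_induct)
  case (insert i A)
  then show ?case by (simp add: p_integral_add)
qed (use p_integral_of_int[of 0] in simp_all)

lemma p_integral_inverse_of_nat:
  assumes "\<not> p dvd m"
  shows "p_integral p (1 / of_nat m)"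
  using p_integral_fraction[of p "int m" 1] assms by simp

text \<open>The way back to the integers: a congruence modulo \<open>p^2\<close> is obtained by
  showing that the difference divided by \<open>p^2\<close> is p-integral. Clearing denominators
  gives \<open>z * b = a * p^n\<close>, and \<open>b\<close> is coprime to \<open>p\<close>, so
  \<open>p^n\<close> must divide \<open>z\<close>.\<close>

lemma dvd_if_p_integral_quotient:
  assumes "p_integral p (of_int z / of_nat p ^ n)"
  shows "int p ^ n dvd z"
proof -
  obtain a b where b: "\<not> int p dvd b" and eq: "of_int z / of_nat p ^ n = (of_int a / of_int b :: rat)"
    using assms unfolding p_integral_def by blast
  have "b \<noteq> 0" "p \<noteq> 0" using b prime by auto
  with eq have "of_int (z * b) = (of_int (a * int p ^ n) :: rat)"
    by (simp add: field_simps)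
  then have "int p ^ n dvd z * b" by (simp only: of_int_eq_iff) simp
  moreover have "coprime (int p ^ n) b"
    using b prime by (intro coprime_power_left_iff[THEN iffD2] disjI1 prime_imp_coprime) auto
  ultimately show ?thesis by (simp add: coprime_dvd_mult_left_iff)
qed

text \<open>The only odd multiple of \<open>p\<close> below \<open>2 * p\<close> is \<open>p\<close>
  itself, where the quotient is 1; any other \<open>m\<close> is invertible at \<open>p\<close>.
  Thus one factor \<open>p\<close> in a numerator pays for an odd denominator in this range.\<close>

lemma p_integral_prime_over_odd:
  assumes "m < 2 * p" "odd m"
  shows "p_integral p (of_nat p / of_nat m)"
proof (cases "p dvd m")
  case True
  then obtain c where c: "m = p * c" by blast
  with assms have "c < 2" "c \<noteq> 0" by (auto elim: oddE)
  then have "m = p" using c by (simp add: less_2_cases_iff)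
  then show ?thesis using p_integral_of_int[of 1] prime by (auto simp: prime_gt_0_nat)
next
  case False
  then show ?thesis
    using p_integral_mult[OF p_integral_of_nat[of p] p_integral_inverse_of_nat[of m]] by simp
qed

text \<open>Passing from \<open>k\<close> to \<open>k + 1\<close> multiplies the product by
  \<open>p^2 / (k+1)^2 - 1\<close>. Since \<open>k + 1 < p\<close> is invertible at
  \<open>p\<close>, this is a mere change of sign modulo \<open>p^2\<close>.\<close>

lemma p_integral_binomial_product:
  assumes "k < p"
  shows "p_integral p ((of_nat (p - 1 choose k) * of_nat ((p + k) choose k) - (-1) ^ k) / of_nat p ^ 2)"
  using assms
proof (induction k)
  case 0
  then show ?case using p_integral_of_int[of 0] by simp
next
  case (Suc k)
  define e :: "nat \<Rightarrow> rat" where "e k = of_nat (p - 1 choose k) * of_nat ((p + k) choose k)" for k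
  have p0: "of_nat p \<noteq> (0::rat)" using Suc.prems by simp
  have "(of_nat k + 1)\<^sup>2 * e (Suc k) =
      ((of_nat k + 1) * of_nat (p - 1 choose Suc k)) * ((of_nat k + 1) * of_nat ((p + Suc k) choose Suc k))"
    by (simp add: e_def power2_eq_square)
  also have "\<dots> = ((of_nat (p - 1) - of_nat k) * of_nat (p - 1 choose k)) *
      ((of_nat p + of_nat k + 1) * of_nat ((p + k) choose k))"
    by (simp only: binomial_Suc_mult[of k "p - 1"] binomial_add_Suc_mult)
  also have "\<dots> = (of_nat p ^ 2 - (of_nat k + 1)\<^sup>2) * e k"
    using Suc.prems by (simp add: e_def of_nat_diff power2_eq_square algebra_simps)
  finally have rec: "(of_nat k + 1)\<^sup>2 * e (Suc k) = (of_nat p ^ 2 - (of_nat k + 1)\<^sup>2) * e k" .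
  have k0: "of_nat k + 1 \<noteq> (0::rat)"
    using of_nat_neq_0[of k, where 'a = rat] by (simp add: add.commute)
  \<comment> \<open>The new error is the negated old one plus \<open>e k / (k+1)^2\<close>, the part
    of the recurrence that carried the factor \<open>p^2\<close>.\<close>
  have eq: "(e (Suc k) - (-1) ^ Suc k) / of_nat p ^ 2 =
      e k * (1 / of_nat (Suc k)) * (1 / of_nat (Suc k)) - (e k - (-1) ^ k) / of_nat p ^ 2"
  proof -
    define K :: rat where "K = of_nat (Suc k)"
    have K: "of_nat k + 1 = K" by (simp add: K_def add.commute)
    have "e (Suc k) = of_nat p ^ 2 * (e k * (1 / K) * (1 / K)) - e k"
      using rec k0 unfolding K by (simp add: field_simps power2_eq_square)
    then show ?thesis
      using p0 unfolding K_def[symmetric] by (simp add: diff_divide_distrib add_divide_distrib)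
  qed
  have "p_integral p (e k)"
    unfolding e_def by (intro p_integral_mult p_integral_of_nat)
  moreover have "p_integral p (1 / of_nat (Suc k))"
    using Suc.prems by (intro p_integral_inverse_of_nat) (auto dest: dvd_imp_le)
  moreover have "p_integral p ((e k - (-1) ^ k) / of_nat p ^ 2)"
    using Suc unfolding e_def by simp
  ultimately have "p_integral p ((e (Suc k) - (-1) ^ Suc k) / of_nat p ^ 2)"
    unfolding eq by (intro p_integral_diff p_integral_mult)
  then show ?case unfolding e_def .
qed

text \<open>Under the reflection of \<open>j\<close> to \<open>p - 1 - j\<close> two denominators
  add up to \<open>2 * p\<close>, and the signs agree because \<open>p - 1\<close> is even. So each
  pair gains a second factor \<open>p\<close>, and only the fixed point \<open>h\<close>, with
  denominator \<open>p\<close>, has to be removed first.\<close>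

lemma p_integral_alternating_odd_sum:
  assumes p: "p = 2 * h + 1" and h: "h > 0"
  shows "p_integral p (((\<Sum>j<p. (-1) ^ j * (of_nat p / (2 * of_nat j + 1))) - (-1) ^ h) / of_nat p ^ 2)"
proof -
  define a :: "nat \<Rightarrow> rat" where "a j = (-1) ^ j * (of_nat p / (2 * of_nat j + 1))" for j
  have p0: "of_nat p \<noteq> (0::rat)" using p by simp
  have ah: "a h = (-1) ^ h"
    using odd_rat_nonzero(2)[of h] by (simp add: a_def p add.commute)
  have "(\<Sum>j<p. a j) = (\<Sum>j<p. a (p - 1 - j))"
    by (subst sum.nat_diff_reindex[symmetric]) simp
  then have "2 * (\<Sum>j<p. a j) = (\<Sum>j<p. a j + a (p - 1 - j))"
    by (simp add: sum.distrib)
  \<comment> \<open>The fixed point \<open>h\<close> appears twice in the doubled sum, so halving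
    leaves one \<open>a h = (-1)^h\<close>.\<close>
  also have "\<dots> = (a h + a (p - 1 - h)) + (\<Sum>j\<in>{..<p}-{h}. a j + a (p - 1 - j))"
    using p by (subst sum.remove[of _ h]) auto
  also have "p - 1 - h = h" using p by simp
  finally have "(\<Sum>j<p. a j) - (-1) ^ h = 1 / 2 * (\<Sum>j\<in>{..<p}-{h}. a j + a (p - 1 - j))"
    by (simp add: ah)
  then have split: "((\<Sum>j<p. a j) - (-1) ^ h) / of_nat p ^ 2 =
      1 / of_nat 2 * (\<Sum>j\<in>{..<p}-{h}. (a j + a (p - 1 - j)) / of_nat p ^ 2)"
    by (simp add: sum_divide_distrib mult.commute)
  have "p_integral p ((a j + a (p - 1 - j)) / of_nat p ^ 2)" if j: "j \<in> {..<p}-{h}" for j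
  proof -
    define i where "i = p - 1 - j"
    have ij: "i + j = 2 * h" and pij: "of_nat p = (of_nat i + of_nat j + 1 :: rat)"
      using j p by (auto simp: i_def)
    have sgn: "(-1) ^ i = ((-1) ^ j :: rat)"
      using ij by (metis even_add even_mult_iff even_numeral minus_one_power_iff)
    \<comment> \<open>For \<open>l < p\<close> we have \<open>2 * l + 1 < 2 * p\<close>, so a
      multiple of \<open>p\<close> could only be \<open>p\<close> itself, which means
      \<open>l = h\<close>.\<close>
    have ndvd: "\<not> p dvd 2 * l + 1" if "l < p" "l \<noteq> h" for l
    proof
      assume "p dvd 2 * l + 1"
      then obtain c where c: "2 * l + 1 = p * c" by blast
      have "c \<noteq> 0" using c by (metis Suc_eq_plus1 mult_0_right nat.distinct(1))
      moreover have "c < 2"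
      proof (rule ccontr)
        assume "\<not> c < 2"
        then have "p * 2 \<le> p * c" by simp
        then show False using c that by linarith
      qed
      ultimately have "c = 1" by simp
      then show False using c p that by simp
    qed
    have "a j + a i = (-1) ^ j * (of_nat p * ((2 * of_nat i + 1) + (2 * of_nat j + 1)) /
        ((2 * of_nat j + 1) * (2 * of_nat i + 1)))"
      using odd_rat_nonzero(2)[of i] odd_rat_nonzero(2)[of j]
      by (simp add: a_def sgn field_simps)
    also have "(2 * of_nat i + 1) + (2 * of_nat j + 1) = 2 * (of_nat p :: rat)"
      using pij by simp
    finally have "(a j + a i) / of_nat p ^ 2 =
        of_int ((-1) ^ j * 2) * (1 / of_nat (2 * j + 1)) * (1 / of_nat (2 * i + 1))"
      using p0 odd_rat_nonzero(2)[of i] odd_rat_nonzero(2)[of j]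
      by (simp add: power2_eq_square add.commute)
    also have "p_integral p \<dots>"
      using j ij p
      by (intro p_integral_mult p_integral_of_int p_integral_inverse_of_nat ndvd) (auto simp: i_def)
    finally show ?thesis by (simp add: i_def)
  qed
  \<comment> \<open>Halving is harmless at \<open>p\<close>, since \<open>h > 0\<close> forces
    \<open>p > 2\<close>.\<close>
  moreover have "p_integral p (1 / of_nat 2)"
    using p h by (intro p_integral_inverse_of_nat) (auto dest: dvd_imp_le)
  ultimately have "p_integral p (1 / of_nat 2 * (\<Sum>j\<in>{..<p}-{h}. (a j + a (p - 1 - j)) / of_nat p ^ 2))"
    by (intro p_integral_mult p_integral_sum)
  then have "p_integral p (((\<Sum>j<p. a j) - (-1) ^ h) / of_nat p ^ 2)"
    by (simp only: split)
  then show ?thesis unfolding a_def .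
qed

end

section \<open>Partial fractions and the quadratic character of -1\<close>

lemma alternating_partial_fractions:
  assumes "odd m"
  shows "(\<Sum>k<m. (-1) ^ k * (1 / ((2 * of_nat k - 1) * (2 * of_nat k + 1)))) =
    (- 1 / 2 + 1 / (2 * (2 * of_nat m - 1)) - (\<Sum>j<m. (-1) ^ j / (2 * of_nat j + 1)) :: rat)"
proof -
  have "(\<Sum>k<m. (-1) ^ k * (1 / ((2 * of_nat k - 1) * (2 * of_nat k + 1)))) =
    (- 1 / 2 - (-1) ^ m / (2 * (2 * of_nat m - 1)) - (\<Sum>j<m. (-1) ^ j / (2 * of_nat j + 1)) :: rat)" for m
  proof (induction m)
    case (Suc m)
    define u v :: rat where "u = 2 * of_nat m - 1" and "v = 2 * of_nat m + 1"
    have uv: "u \<noteq> 0" "v \<noteq> 0" "v = u + 2"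
      unfolding u_def v_def using odd_rat_nonzero[of m] by simp_all
    have split: "1 / (u * v) = (1 / u - 1 / v) / 2"
      using uv(1,2) by (simp add: field_simps) (simp add: uv(3))
    \<comment> \<open>The alternating sign makes the halves with equal denominator from neighbouring
      \<open>k\<close> add up instead of cancel. One full term \<open>(-1)^m / v\<close> is left
      behind, together with the next boundary term.\<close>
    have "- ((-1) ^ m / (2 * u)) + (-1) ^ m * (1 / (u * v)) = - ((-1) ^ Suc m / (2 * v)) - (-1) ^ m / v"
      unfolding split using uv(1,2) by (cases "even m") (simp_all add: field_simps)
    moreover have "2 * of_nat (Suc m) - 1 = v" by (simp add: v_def)
    ultimately show ?case
      using Suc.IH unfolding sum.lessThan_Suc u_def[symmetric] v_def[symmetric] by simp
  qed simp
  with assms show ?thesis by simp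
qed

text \<open>Euler's criterion gives the equality modulo \<open>p\<close>; the two sides differ by at
  most 2, which is less than \<open>p\<close>.\<close>

lemma Legendre_minus_one:
  assumes "prime p" "p = 2 * h + 1"
  shows "Legendre (-1) (int p) = (-1) ^ h"
proof -
  have p: "2 < p" using prime_ge_2_nat[OF assms(1)] assms(2) by presburger
  have "[Legendre (-1) (int p) = (-1) ^ ((p - 1) div 2)] (mod int p)"
    using euler_criterion[of p "-1"] assms p by simp
  then have "int p dvd Legendre (-1) (int p) - (-1) ^ h"
    using assms by (simp add: cong_iff_dvd_diff)
  moreover have "\<bar>Legendre (-1) (int p) - (-1) ^ h\<bar> \<le> 2"
    by (auto simp: Legendre_def minus_one_power_iff)
  ultimately show ?thesis
    using p dvd_imp_le_int[of "Legendre (-1) (int p) - (-1) ^ h" "int p"] by auto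
qed

section \<open>The sum of \<open>R n\<close> at 1 and its congruence modulo
  \<open>p^2\<close>\<close>

lemma poly_R_eq_sum_lessThan:
  assumes "n < m"
  shows "(of_int (poly (R n) x) :: rat) =
    (\<Sum>k<m. of_nat (n choose k) * of_nat ((n + k) choose k) * (of_int x ^ k / (2 * of_nat k - 1)))"
  unfolding of_int_poly_R
  using assms by (intro sum.mono_neutral_left) (auto simp: binomial_eq_0)

text \<open>Padding every \<open>R n\<close> with zero terms to the common range
  \<open>k < m\<close> allows the two sums to be swapped; \<open>sum_binomial_products\<close>
  closes the inner one. The absorption \<open>(m - k) * C(m,k) = m * C(m-1,k)\<close> then exposes
  the factor \<open>m\<close>, later \<open>p\<close>.\<close>

lemma sum_R_at_one:
  assumes "m > 0"
  shows "(of_int (\<Sum>n<m. poly (R n) 1) :: rat) =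
    (\<Sum>k<m. of_nat m / ((2 * of_nat k - 1) * (2 * of_nat k + 1)) *
      (of_nat (m - 1 choose k) * of_nat ((m + k) choose k)))"
proof -
  have "(of_int (\<Sum>n<m. poly (R n) 1) :: rat) =
    (\<Sum>n<m. \<Sum>k<m. of_nat (n choose k) * of_nat ((n + k) choose k) * (1 / (2 * of_nat k - 1)))"
    by (simp add: poly_R_eq_sum_lessThan[of _ m])
  also have "\<dots> = (\<Sum>k<m. (1 / (2 * of_nat k - 1)) *
      (\<Sum>n<m. of_nat (n choose k) * of_nat ((n + k) choose k)))"
    by (subst sum.swap) (simp add: sum_distrib_left mult.commute)
  also have "\<dots> = (\<Sum>k<m. of_nat m / ((2 * of_nat k - 1) * (2 * of_nat k + 1)) *
      (of_nat (m - 1 choose k) * of_nat ((m + k) choose k)))"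
  proof (intro sum.cong refl)
    fix k
    have "(of_nat m - of_nat k) * of_nat (m choose k) = of_nat m * (of_nat (m - 1 choose k) :: rat)"
      using binomial_mult_diff[of "m - 1" k] assms by (simp add: of_nat_diff mult.commute)
    then have "(\<Sum>n<m. of_nat (n choose k) * of_nat ((n + k) choose k)) =
        of_nat m * of_nat (m - 1 choose k) * of_nat ((m + k) choose k) / (2 * of_nat k + 1 :: rat)"
      using sum_binomial_products[of k m] odd_rat_nonzero(2)[of k]
      by (simp add: eq_divide_eq mult.commute)
    then show "1 / (2 * of_nat k - 1) * (\<Sum>n<m. of_nat (n choose k) * of_nat ((n + k) choose k)) =
      of_nat m / ((2 * of_nat k - 1) * (2 * of_nat k + 1)) *
      (of_nat (m - 1 choose k) * of_nat ((m + k) choose k) :: rat)"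
      by (simp add: mult.assoc)
  qed
  finally show ?thesis .
qed

lemma sum_R_cong:
  assumes prime: "prime p" and odd: "odd p"
  shows "[(\<Sum>k=0..p-1. poly (R k) 1) = - int p - Legendre (-1) (int p)] (mod (int p)\<^sup>2)"
proof -
  obtain h where p: "p = 2 * h + 1" using odd by (rule oddE)
  have h: "h > 0" using p prime by (metis add_0 gr0I mult_0_right not_prime_1)
  define P :: rat where "P = of_nat p"
  define S where "S = (\<Sum>k=0..p-1. poly (R k) 1)"
  define e :: "nat \<Rightarrow> rat" where "e k = of_nat (p - 1 choose k) * of_nat ((p + k) choose k)" for k
  define w :: "nat \<Rightarrow> rat" where "w k = P / ((2 * of_nat k - 1) * (2 * of_nat k + 1))" for k
  define A :: rat where "A = (\<Sum>j<p. (-1) ^ j * (P / (2 * of_nat j + 1)))"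
  have P0: "P \<noteq> 0" using p by (simp add: P_def)
  have P1: "2 * P - 1 \<noteq> 0" unfolding P_def by (rule odd_rat_nonzero)
  have "S = (\<Sum>n<p. poly (R n) 1)"
    unfolding S_def using p by (intro sum.cong) auto
  then have "of_int S = (\<Sum>k<p. w k * e k)"
    using sum_R_at_one[of p] p by (simp add: w_def e_def P_def)
  \<comment> \<open>Split \<open>e k\<close> into its error, divisible by \<open>p^2\<close>, and
    its leading part \<open>(-1)^k\<close>.\<close>
  also have "\<dots> = (\<Sum>k<p. w k * (e k - (-1) ^ k)) + P * (\<Sum>k<p. (-1) ^ k * (1 / ((2 * of_nat k - 1) * (2 * of_nat k + 1))))"
    unfolding sum_distrib_left sum.distrib[symmetric]
    by (intro sum.cong refl) (simp add: w_def right_diff_distrib)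
  also have "P * (\<Sum>k<p. (-1) ^ k * (1 / ((2 * of_nat k - 1) * (2 * of_nat k + 1)))) =
      P * (- 1 / 2 + 1 / (2 * (2 * P - 1))) - A"
    unfolding alternating_partial_fractions[OF odd]
    by (simp add: A_def P_def right_diff_distrib sum_distrib_left algebra_simps)
  \<comment> \<open>The two boundary contributions combine into the \<open>- p\<close> of the claim
    and a multiple of \<open>p^2\<close>, as \<open>2 * p - 1\<close> is prime to
    \<open>p\<close>.\<close>
  also have "P * (- 1 / 2 + 1 / (2 * (2 * P - 1))) = P\<^sup>2 / (2 * P - 1) - P"
    using P1 by (simp add: field_simps power2_eq_square)
  finally have "of_int (S - (- int p - (-1) ^ h)) =
      (\<Sum>k<p. w k * (e k - (-1) ^ k)) - (A - (-1) ^ h) + P\<^sup>2 * (1 / (2 * P - 1))"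
    by (simp add: P_def)
  then have "(of_int (S - (- int p - (-1) ^ h)) / of_nat p ^ 2 :: rat) =
      (\<Sum>k<p. w k * (e k - (-1) ^ k)) / of_nat p ^ 2 - (A - (-1) ^ h) / of_nat p ^ 2 + 1 / (2 * P - 1)"
    using P0 by (simp only: add_divide_distrib diff_divide_distrib) (simp add: P_def)
  also have "(\<Sum>k<p. w k * (e k - (-1) ^ k)) / of_nat p ^ 2 =
      (\<Sum>k<p. w k * ((e k - (-1) ^ k) / of_nat p ^ 2))"
    by (simp add: sum_divide_distrib)
  finally have "(of_int (S - (- int p - (-1) ^ h)) / of_nat p ^ 2 :: rat) =
      (\<Sum>k<p. w k * ((e k - (-1) ^ k) / of_nat p ^ 2)) - (A - (-1) ^ h) / of_nat p ^ 2 + 1 / (2 * P - 1)" .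
  moreover have "p_integral p (\<Sum>k<p. w k * ((e k - (-1) ^ k) / of_nat p ^ 2))"
  proof (intro p_integral_sum[OF prime] p_integral_mult[OF prime])
    fix k assume k: "k \<in> {..<p}"
    show "p_integral p ((e k - (-1) ^ k) / of_nat p ^ 2)"
      using p_integral_binomial_product[OF prime, of k] k by (simp add: e_def)
    have half: "p_integral p (1 / of_nat 2)"
      using p h by (intro p_integral_inverse_of_nat[OF prime]) (auto dest: dvd_imp_le)
    have up: "p_integral p (of_nat p / of_nat (2 * k + 1))"
      using k by (intro p_integral_prime_over_odd[OF prime]) auto
    have down: "p_integral p (P / (2 * of_nat k - 1))"
    \<comment> \<open>At \<open>k = 0\<close> the denominator is -1; for \<open>k = l + 1\<close> it
      is the odd natural number \<open>2 * l + 1\<close>.\<close>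
    proof (cases k)
      case 0
      then show ?thesis using p_integral_of_int[OF prime, of "- int p"] by (simp add: P_def)
    next
      case (Suc l)
      then have "p_integral p (of_nat p / of_nat (2 * l + 1))"
        using k by (intro p_integral_prime_over_odd[OF prime]) auto
      then show ?thesis using Suc by (simp add: P_def add.commute)
    qed
    \<comment> \<open>Separating the two odd denominators shows that the single factor
      \<open>p\<close> in \<open>w k\<close> suffices: it has to compensate only one of them in each
      fraction.\<close>
    have "w k = 1 / of_nat 2 * (P / (2 * of_nat k - 1) - of_nat p / of_nat (2 * k + 1))"
      using odd_rat_nonzero[of k] by (simp add: w_def P_def divide_simps) (simp add: algebra_simps)
    then show "p_integral p (w k)"
      using p_integral_mult[OF prime half p_integral_diff[OF prime down up]] by (simp only:)
  qed
  moreover have "p_integral p ((A - (-1) ^ h) / of_nat p ^ 2)"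
    using p_integral_alternating_odd_sum[OF prime p h] by (simp add: A_def P_def)
  moreover have "p_integral p (1 / (2 * P - 1))"
  proof -
    have "\<not> int p dvd 2 * int p - 1"
    proof
      assume "int p dvd 2 * int p - 1"
      then have "int p dvd 2 * int p - (2 * int p - 1)" by (rule dvd_diff[OF dvd_triv_right])
      then show False using prime by (auto dest: prime_gt_1_nat)
    qed
    then show ?thesis
      using p_integral_fraction[of p "2 * int p - 1" 1] by (simp add: P_def)
  qed
  ultimately have "p_integral p (of_int (S - (- int p - (-1) ^ h)) / of_nat p ^ 2)"
    using prime by (simp only: p_integral_add p_integral_diff)
  then have "int p ^ 2 dvd S - (- int p - (-1) ^ h)"
    by (rule dvd_if_p_integral_quotient[OF prime])
  then show ?thesis
    by (simp add: S_def cong_iff_dvd_diff Legendre_minus_one[OF prime p])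
qed

section \<open>Telescoping and the value of \<open>R n\<close> at -1\<close>

lemma alternating_binomial_product_partial_sum:
  "(of_nat n + 1)\<^sup>2 * (\<Sum>k<m. (-1) ^ k * of_nat (Suc n choose k) * of_nat ((n + k) choose k)) =
    - (of_nat m ^ 2) * ((-1) ^ m * of_nat (Suc n choose m) * (of_nat ((n + m) choose m) :: rat))"
proof (induction m)
  case (Suc m)
  \<comment> \<open>Write \<open>t m\<close> for the signed summand. The ratio relation is
    \<open>(m+1)^2 * t (m+1) = - ((n+1)^2 - m^2) * t m\<close>, so \<open>- m^2 * t m\<close> grows
    by exactly \<open>(n+1)^2 * t m\<close>.\<close>
  have "of_nat (Suc m) ^ 2 * (of_nat (Suc n choose Suc m) * (of_nat ((n + Suc m) choose Suc m) :: rat)) =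
     ((of_nat m + 1) * of_nat (Suc n choose Suc m)) * ((of_nat m + 1) * of_nat ((n + Suc m) choose Suc m))"
    by (simp add: power2_eq_square algebra_simps del: binomial_Suc_Suc)
  also have "\<dots> = ((of_nat (Suc n) - of_nat m) * of_nat (Suc n choose m)) *
     ((of_nat n + of_nat m + 1) * of_nat ((n + m) choose m))"
    by (simp only: binomial_Suc_mult[of m "Suc n"] binomial_add_Suc_mult)
  also have "\<dots> = ((of_nat n + 1)\<^sup>2 - of_nat m ^ 2) * (of_nat (Suc n choose m) * of_nat ((n + m) choose m))"
    by (simp add: power2_eq_square algebra_simps)
  finally have step: "of_nat (Suc m) ^ 2 * (of_nat (Suc n choose Suc m) * (of_nat ((n + Suc m) choose Suc m) :: rat))
    = ((of_nat n + 1)\<^sup>2 - of_nat m ^ 2) * (of_nat (Suc n choose m) * of_nat ((n + m) choose m))" .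
  have "- (of_nat (Suc m) ^ 2) * ((-1) ^ Suc m * of_nat (Suc n choose Suc m) * (of_nat ((n + Suc m) choose Suc m) :: rat))
    = (-1) ^ m * (of_nat (Suc m) ^ 2 * (of_nat (Suc n choose Suc m) * of_nat ((n + Suc m) choose Suc m)))"
    by (simp add: mult_ac del: binomial_Suc_Suc of_nat_Suc)
  also note step
  finally show ?case
    unfolding sum.lessThan_Suc distrib_left Suc.IH by (simp only:) (simp add: algebra_simps del: binomial_Suc_Suc)
qed simp

text \<open>At \<open>m = n + 2\<close> the closed form of the partial sum contains
  \<open>C(n+1,n+2) = 0\<close>. This is a case of the Chu-Vandermonde identity.\<close>

lemma alternating_binomial_product_sum:
  "(\<Sum>k<Suc (Suc n). (-1) ^ k * of_nat (Suc n choose k) * of_nat ((n + k) choose k)) = (0 :: rat)"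
proof -
  have "(of_nat n + 1)\<^sup>2 * (\<Sum>k<Suc (Suc n). (-1) ^ k * of_nat (Suc n choose k) * of_nat ((n + k) choose k)) = (0 :: rat)"
    unfolding alternating_binomial_product_partial_sum by (simp add: binomial_eq_0 del: binomial_Suc_Suc)
  moreover have "of_nat n + 1 \<noteq> (0 :: rat)"
    using of_nat_neq_0[of n, where 'a = rat] by (simp add: add.commute)
  ultimately show ?thesis by (simp del: sum.lessThan_Suc)
qed

text \<open>The mixed product \<open>s\<close> lies between the coefficients belonging to
  \<open>n\<close> and \<open>n + 1\<close>; up to the factor \<open>n + 1\<close>, both are
  \<open>s\<close> times something linear in \<open>k\<close>. Linear combinations of consecutive
  \<open>R n\<close> thereby reduce to sums over \<open>s\<close>.\<close>

lemma binomial_products_via_Suc: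
  fixes n k :: nat
  defines "s \<equiv> of_nat (Suc n choose k) * of_nat ((n + k) choose k) :: rat"
  shows "(of_nat n + 1) * (of_nat (n choose k) * of_nat ((n + k) choose k)) = (of_nat n + 1 - of_nat k) * s"
    and "(of_nat n + 1) * (of_nat (Suc n choose k) * of_nat ((Suc n + k) choose k)) = (of_nat n + 1 + of_nat k) * s"
proof -
  show "(of_nat n + 1) * (of_nat (n choose k) * of_nat ((n + k) choose k)) = (of_nat n + 1 - of_nat k) * s"
    unfolding s_def mult.assoc[symmetric] binomial_mult_diff[symmetric] by (simp only: mult_ac)
  show "(of_nat n + 1) * (of_nat (Suc n choose k) * of_nat ((Suc n + k) choose k)) = (of_nat n + 1 + of_nat k) * s"
    using arg_cong[OF binomial_add_mult[of n k], of "\<lambda>t. of_nat (Suc n choose k) * t"]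
    unfolding s_def by (simp only: mult_ac)
qed

lemma R_at_minus_one: "poly (R n) (-1) = - (2 * int n + 1)"
proof (induction n)
  case 0
  show ?case by (simp add: R_def poly_monom)
next
  case (Suc n)
  let ?N = "of_nat n :: rat"
  let ?r = "\<lambda>m. of_int (poly (R m) (-1)) :: rat"
  let ?s = "\<lambda>k. of_nat (Suc n choose k) * of_nat ((n + k) choose k) :: rat"
  let ?c = "\<lambda>m k. of_nat (m choose k) * of_nat ((m + k) choose k) :: rat"
  have N: "?N + 1 \<noteq> 0"
    using of_nat_neq_0[of n, where 'a = rat] by (simp add: add.commute)
  have r: "?r m = (\<Sum>k<Suc (Suc n). ?c m k * ((-1) ^ k / (2 * of_nat k - 1)))" if "m \<le> Suc n" for m
    using poly_R_eq_sum_lessThan[of m "Suc (Suc n)" "-1"] that by simp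
  \<comment> \<open>The outer factor \<open>?N + 1\<close> clears the denominators in the
    expressions through \<open>?s\<close>.\<close>
  have "(?N + 1) * ((2 * ?N + 1) * ?r (Suc n) - (2 * ?N + 3) * ?r n) =
     (\<Sum>k<Suc (Suc n). ((2 * ?N + 1) * ((?N + 1) * ?c (Suc n) k) - (2 * ?N + 3) * ((?N + 1) * ?c n k))
        * ((-1) ^ k / (2 * of_nat k - 1)))"
    unfolding r[OF order_refl] r[OF le_SucI[OF order_refl]]
    by (simp only: sum_distrib_left sum_subtractf[symmetric]) (intro sum.cong refl, simp only: algebra_simps)
  also have "\<dots> = (\<Sum>k<Suc (Suc n). 2 * (?N + 1) * ((-1) ^ k * of_nat (Suc n choose k) * of_nat ((n + k) choose k)))"
  proof (intro sum.cong refl)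
    fix k
    \<comment> \<open>The weights are chosen so that
      \<open>(2N+1)(N+1+k) - (2N+3)(N+1-k) = 2(N+1)(2k-1)\<close>, which cancels the denominator
      \<open>2k-1\<close>.\<close>
    have "(2 * ?N + 1) * ((?N + 1) * ?c (Suc n) k) - (2 * ?N + 3) * ((?N + 1) * ?c n k) =
        (2 * of_nat k - 1) * (2 * (?N + 1) * ?s k)"
      unfolding binomial_products_via_Suc by (simp only: algebra_simps)
    then show "((2 * ?N + 1) * ((?N + 1) * ?c (Suc n) k) - (2 * ?N + 3) * ((?N + 1) * ?c n k))
        * ((-1) ^ k / (2 * of_nat k - 1)) = 2 * (?N + 1) * ((-1) ^ k * of_nat (Suc n choose k) * of_nat ((n + k) choose k))"
      using odd_rat_nonzero(1)[of k] by (simp only:) (simp add: mult_ac)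
  qed
  also have "\<dots> = 0"
    unfolding sum_distrib_left[symmetric] alternating_binomial_product_sum by simp
  finally have "(2 * ?N + 1) * ?r (Suc n) = (2 * ?N + 3) * ?r n"
    using N by simp
  also have "?r n = - (2 * ?N + 1)" by (simp add: Suc.IH)
  also have "(2 * ?N + 3) * - (2 * ?N + 1) = (2 * ?N + 1) * - (2 * ?N + 3)"
    by (simp only: mult_minus_right mult.commute)
  finally have "?r (Suc n) = - (2 * ?N + 3)"
    by (rule mult_left_cancel[OF odd_rat_nonzero(2), THEN iffD1])
  also have "\<dots> = of_int (- (2 * int (Suc n) + 1))" by simp
  finally show ?case by (simp only: of_int_eq_iff)
qed

section \<open>The sum with negative upper argument\<close>

lemma gbinomial_minus_of_nat:
  "((- of_nat (Suc n)) gchoose k) = (-1) ^ k * (of_nat ((n + k) choose k) :: rat)"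
  using gbinomial_negated_upper[of "- of_nat (Suc n) :: rat" k]
  by (simp add: binomial_gbinomial add.commute)

text \<open>Upper negation turns the summand into \<open>(-1)^k\<close> times the mixed product,
  over \<open>2k-1\<close>. With equal weights the \<open>k\<close>-dependence cancels,
  \<open>(n+k) + (n-k) = 2n\<close>, so the mixed product is the mean of the coefficients for
  \<open>n\<close> and \<open>n - 1\<close>, and the sum is half of
  \<open>- (2n+1) - (2n-1) = - 4n\<close>.\<close>

lemma sum_binomial_minus_upper:
  assumes "n > 0"
  shows "(\<Sum>k=0..n. of_nat (n choose k) * ((- of_nat n) gchoose k) / (2 * of_nat k - 1)) = (- 2 * of_nat n :: rat)"
proof -
  obtain m where n: "n = Suc m" using assms by (cases n) auto
  let ?M = "of_nat m :: rat"
  let ?s = "\<lambda>k. of_nat (Suc m choose k) * of_nat ((m + k) choose k) :: rat"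
  let ?c = "\<lambda>m k. of_nat (m choose k) * of_nat ((m + k) choose k) :: rat"
  have M: "?M + 1 \<noteq> 0"
    using of_nat_neq_0[of m, where 'a = rat] by (simp add: add.commute)
  have mean: "2 * ?s k = ?c (Suc m) k + ?c m k" for k
  proof -
    have "(?M + 1) * (?c (Suc m) k + ?c m k) = (?M + 1) * (2 * ?s k)"
      unfolding distrib_left[of "?M + 1" "?c (Suc m) k"] binomial_products_via_Suc by (simp only: algebra_simps)
    then show ?thesis by (rule mult_left_cancel[OF M, THEN iffD1, symmetric])
  qed
  have "2 * (\<Sum>k=0..n. of_nat (n choose k) * ((- of_nat n) gchoose k) / (2 * of_nat k - 1)) =
      (\<Sum>k<Suc n. (2 * ?s k) * ((-1) ^ k / (2 * of_nat k - 1)))"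
    unfolding n gbinomial_minus_of_nat atLeast0AtMost lessThan_Suc_atMost sum_distrib_left
    by (intro sum.cong refl) (simp add: mult_ac del: binomial_Suc_Suc)
  also have "\<dots> = of_int (poly (R (Suc m)) (-1)) + of_int (poly (R m) (-1))"
    using poly_R_eq_sum_lessThan[of "Suc m" "Suc n" "-1"] poly_R_eq_sum_lessThan[of "m" "Suc n" "-1"]
    unfolding mean distrib_right sum.distrib n by simp
  also have "\<dots> = 2 * (- 2 * of_nat n)"
    by (simp add: R_at_minus_one n)
  finally show ?thesis by simp
qed

theorem theorem1p3:
  shows "(\<forall>p :: nat. prime p \<and> odd p \<longrightarrow>
      [(\<Sum>k=0..p-1. poly (R k) 1) = - int p - Legendre (-1) (int p)] (mod (int p)\<^sup>2))
    \<and> (\<forall>n :: nat. n > 0 \<longrightarrow>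
      poly (R n) (-1) = - (2 * int n + 1) \<and>
      (\<Sum>k=0..n. of_nat (n choose k) * ((- of_nat n) gchoose k) / (2 * of_nat k - 1))
        = (- 2 * of_nat n :: rat))"
  using sum_R_cong R_at_minus_one sum_binomial_minus_upper by blast

end
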